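(* Let $n_0=0$ and $n_k=4^{k^2}+n_{k-1}$ for $k\in\mathbb{N}=\{1,2,\dots\}$. For $k\in\mathbb{N}$ and $n\in(n_{k-1},n_k]$ put $x_n=\frac{1}{4^{k^2}}$ and $y_n=\frac{1}{2^k}$. Define a sequence $(v_n)$ in $\mathbb{R}^2$ by $v_{4n-3}=(-x_{2n-1},-y_{2n-1})$, $v_{4n-2}=(-x_{2n-1},y_{2n-1})$, $v_{4n-1}=(x_{2n},y_{2n})$, $v_{4n}=(x_{2n},-y_{2n})$ for every $n\in\mathbb{N}$. Then the conditionally convergent series $\sum_{n=1}^\infty v_n$ has exactly two Levy vectors, $\mathrm{A}(v_n)=\mathbb{R}^2$, and $\mathrm{A}_{\mathrm{abs}}(v_n)\cap\left(\{\tfrac13\}\times\mathbb{R}\right)=\emptyset$; in particular $\mathrm{A}_{\mathrm{abs}}(v_n)\ne\mathrm{A}(v_n)=\mathbb{R}^2$.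
   Context: A series $\sum_{n=1}^\infty v_n$ in $\mathbb{R}^2$ is conditionally convergent if it converges but $\sum_{n=1}^\infty\Vert v_n\Vert=\infty$. A vector $u\in\mathbb{R}^2$ with $\Vert u\Vert=1$ is a Levy vector of $\sum_{n=1}^\infty v_n$ if for every $\varepsilon>0$ we have $\sum_{n:\,v_n\in S_\varepsilon(u)}\Vert v_n\Vert=\infty$, where $S_\varepsilon(u)=\{v\in\mathbb{R}^2:\langle u,v\rangle\ge(1-\varepsilon)\Vert u\Vert\,\Vert v\Vert\}$. $\mathrm{A}(v_n)$ is the set of sums $\sum_{n=1}^\infty\varepsilon_nv_n$ over all $(\varepsilon_n)\in\{0,1\}^{\mathbb{N}}$ for which this series converges. $\mathrm{A}_{\mathrm{abs}}(v_n)$ is the set of sums $\sum_{n=1}^\infty\varepsilon_nv_n$ over all $(\varepsilon_n)\in\{0,1\}^{\mathbb{N}}$ with $\sum_{n=1}^\infty\varepsilon_n\Vert v_n\Vert<\infty$. *)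

theory Defs
  imports "HOL-Analysis.Analysis"
begin

text \<open>
  The plane is \<^typ>\<open>real \<times> real\<close>, whose library norm and inner product are the Euclidean ones.
  All notions below take series indexed from 0, as the library does; a series with terms
  \<open>v 1, v 2, \<dots>\<close> is passed as \<open>\<lambda>n. v (Suc n)\<close>.
\<close>

definition conditionally_convergent :: "(nat \<Rightarrow> real \<times> real) \<Rightarrow> bool" where
  "conditionally_convergent v \<longleftrightarrow> summable v \<and> \<not> summable (\<lambda>n. norm (v n))"

definition levy_cone :: "real \<Rightarrow> real \<times> real \<Rightarrow> (real \<times> real) set" where
  "levy_cone \<epsilon> u = {v. u \<bullet> v \<ge> (1 - \<epsilon>) * norm u * norm v}"

text \<open>
  For nonnegative terms, failure of \<open>summable_on\<close> says exactly that the sum is infinite.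
\<close>

definition levy_vector :: "(nat \<Rightarrow> real \<times> real) \<Rightarrow> real \<times> real \<Rightarrow> bool" where
  "levy_vector v u \<longleftrightarrow> norm u = 1 \<and>
     (\<forall>\<epsilon>>0. \<not> (\<lambda>n. norm (v n)) summable_on {n. v n \<in> levy_cone \<epsilon> u})"

definition achievement_set :: "(nat \<Rightarrow> real \<times> real) \<Rightarrow> (real \<times> real) set" where
  "achievement_set v =
     {(\<Sum>n. e n *\<^sub>R v n) | e :: nat \<Rightarrow> real.
        (\<forall>n. e n \<in> {0, 1}) \<and> summable (\<lambda>n. e n *\<^sub>R v n)}"

definition abs_achievement_set :: "(nat \<Rightarrow> real \<times> real) \<Rightarrow> (real \<times> real) set" where
  "abs_achievement_set v =
     {(\<Sum>n. e n *\<^sub>R v n) | e :: nat \<Rightarrow> real.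
        (\<forall>n. e n \<in> {0, 1}) \<and> summable (\<lambda>n. e n * norm (v n))}"

end

theory Submission
  imports Defs
begin

text \<open>
  The terms of the series come in consecutive quadruples
  \<open>(-\<alpha>, -\<beta>), (-\<alpha>, \<beta>), (\<alpha>, \<beta>), (\<alpha>, -\<beta>)\<close> that run through all sign choices; in block \<open>k\<close>
  there are \<open>4^(k^2) / 2\<close> of them, with \<open>\<alpha> = 4^-(k^2)\<close> and \<open>\<beta> = 2^-k\<close>. Everything except
  the avoidance of the abscissa \<open>1/3\<close> and its consequence rests only on the facts that \<open>\<beta>\<close> and \<open>\<alpha> / \<beta>\<close> tend to zero and that the \<open>\<alpha>\<close>
  have infinite sum, as they do because each block contributes \<open>1/2\<close>.

  Each quadruple sums to zero and the terms tend to zero, so the series converges to zero, while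
  the norms dominate the divergent series of the \<open>\<beta>\<close>. Since \<open>\<alpha> / \<beta>\<close> tends to zero, the directions
  of the terms accumulate exactly at \<open>(0, 1)\<close> and \<open>(0, -1)\<close>: these two are Levy vectors, and a narrow
  cone around any other direction contains only finitely many terms.

  For the achievement set, select exactly one vector from every quadruple. This amounts to choosing
  the signs of \<open>\<alpha>\<close> and \<open>\<beta>\<close> independently, so the planar problem splits into two problems on the line:
  null sequences of positive reals with infinite sum can be given signs so as to converge to any
  prescribed real (\<open>exists_signs_sums\<close>).

  Absolute convergence of a subseries bounds the sum of the selected \<open>\<beta>\<close>, and beyond block \<open>K\<close> the
  selected \<open>\<alpha>\<close> are so much smaller than the \<open>\<beta>\<close> that their sum, multiplied by \<open>4^(K^2)\<close>, tends to
  zero as \<open>K\<close> grows. The first \<open>K\<close> blocks contribute to the abscissa a fraction with denominator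
  \<open>4^(K^2)\<close>. Hence the distance of \<open>4^(K^2) t\<close> to the integers tends to zero for every abscissa \<open>t\<close> of an
  absolutely convergent subsum (\<open>not_abs_achievable\<close>), whereas for \<open>t = 1/3\<close> this distance is at
  least \<open>1/3\<close>.
\<close>

section \<open>Grouping terms and choosing signs\<close>

text \<open>
  Brackets of fixed length may be removed from a convergent series when its terms tend to zero: a
  partial sum then differs from a bracketed one by fewer than \<open>k\<close> small terms.
\<close>

lemma sums_ungroup:
  fixes f :: "nat \<Rightarrow> 'a::real_normed_vector"
  assumes k: "0 < k" and f0: "f \<longlonglongrightarrow> 0"
    and grp: "(\<lambda>n. sum f {n * k..<n * k + k}) sums s"
  shows "f sums s"
proof -
  define T where "T n = sum f {..<n * k}" for n
  have T: "T \<longlonglongrightarrow> s"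
  proof -
    have "(\<Sum>m<n. sum f {m * k..<m * k + k}) = T n" for n
      unfolding T_def by (rule sum.nat_group)
    then show ?thesis using grp by (simp add: sums_def)
  qed
  have dv: "filterlim (\<lambda>n. n div k) sequentially sequentially"
    unfolding filterlim_at_top
  proof
    fix Z
    show "\<forall>\<^sub>F n in sequentially. Z \<le> n div k"
      using eventually_ge_at_top[of "Z * k"]
      by eventually_elim (use k in \<open>simp add: less_eq_div_iff_mult_less_eq\<close>)
  qed
  have R: "(\<lambda>n. sum f {n div k * k..<n}) \<longlonglongrightarrow> 0"
  proof (rule tendsto_norm_zero_cancel, rule tendsto_sandwich[OF _ _ tendsto_const])
    have sh: "filterlim (\<lambda>n. n * k + r) sequentially sequentially" for r
      using k by (intro filterlim_subseq) (auto simp: strict_mono_def)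
    have "(\<lambda>n. \<Sum>r<k. norm (f (n * k + r))) \<longlonglongrightarrow> (\<Sum>r<k. norm (0::'a))"
      by (intro tendsto_sum tendsto_norm filterlim_compose[OF f0 sh])
    then have "(\<lambda>n. \<Sum>r<k. norm (f (n * k + r))) \<longlonglongrightarrow> 0" by simp
    from filterlim_compose[OF this dv]
    show "(\<lambda>n. \<Sum>r<k. norm (f (n div k * k + r))) \<longlonglongrightarrow> 0" .
    show "\<forall>\<^sub>F n in sequentially. norm (sum f {n div k * k..<n})
            \<le> (\<Sum>r<k. norm (f (n div k * k + r)))"
    proof (rule always_eventually, rule allI)
      fix n
      have "{n div k * k..<n} \<subseteq> {n div k * k..<n div k * k + k}"
        using dividend_less_div_times[OF k, of n] by (auto simp: add.commute)
      then have "sum (\<lambda>i. norm (f i)) {n div k * k..<n}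
          \<le> sum (\<lambda>i. norm (f i)) {n div k * k..<n div k * k + k}"
        by (intro sum_mono2) auto
      also have "\<dots> = (\<Sum>r<k. norm (f (n div k * k + r)))"
        using sum.shift_bounds_nat_ivl[of "\<lambda>i. norm (f i)" 0 "n div k * k" k]
        by (simp add: lessThan_atLeast0 add.commute)
      finally show "norm (sum f {n div k * k..<n}) \<le> (\<Sum>r<k. norm (f (n div k * k + r)))"
        using norm_sum[of f "{n div k * k..<n}"] by linarith
    qed
  qed auto
  have "sum f {..<n} = T (n div k) + sum f {n div k * k..<n}" for n
    unfolding T_def lessThan_atLeast0
    by (rule sum.atLeastLessThan_concat[symmetric]) auto
  then show ?thesis
    using tendsto_add[OF filterlim_compose[OF T dv] R] by (simp add: sums_def)
qed

text \<open>
  The signs are chosen greedily, always stepping towards \<open>p\<close>. As the total step length is infinite,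
  the partial sums come within \<open>\<delta>\<close> of \<open>p\<close> after the steps have become shorter than \<open>\<delta>\<close>, and from
  then on no step can leave the \<open>\<delta>\<close>-neighbourhood.
\<close>

lemma exists_signs_sums:
  fixes c :: "nat \<Rightarrow> real"
  assumes nonneg: "\<And>n. 0 \<le> c n" and c0: "c \<longlonglongrightarrow> 0" and div: "\<not> summable c"
  obtains \<sigma> where "\<And>n. \<sigma> n \<in> {-1, 1}" and "(\<lambda>n. \<sigma> n * c n) sums p"
proof -
  \<comment> \<open>the signed distance of the partial sum from the target \<open>p\<close>\<close>
  define d where "d = rec_nat (- p) (\<lambda>n z. if z < 0 then z + c n else z - c n)"
  have d_0: "d 0 = - p" and d_Suc: "d (Suc n) = (if d n < 0 then d n + c n else d n - c n)" for n
    by (simp_all add: d_def)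
  define \<sigma> where "\<sigma> n = (if d n < 0 then 1 else - 1 :: real)" for n
  have partial: "(\<Sum>i<n. \<sigma> i * c i) = d n + p" for n
    by (induction n) (auto simp: d_0 d_Suc \<sigma>_def)
  have "d \<longlonglongrightarrow> 0"
  proof (rule LIMSEQ_I)
    fix \<epsilon> :: real
    assume "0 < \<epsilon>"
    define \<delta> where "\<delta> = \<epsilon> / 2"
    have "0 < \<delta>" using \<open>0 < \<epsilon>\<close> by (simp add: \<delta>_def)
    then obtain M where "\<forall>n\<ge>M. norm (c n - 0) < \<delta>" using LIMSEQ_D[OF c0] by blast
    then have M: "c n < \<delta>" if "n \<ge> M" for n using that by force
    have "\<exists>m\<ge>M. \<bar>d m\<bar> \<le> \<delta>"
    proof (rule ccontr)
      assume "\<not> ?thesis"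
      then have big: "\<bar>d m\<bar> > \<delta>" if "m \<ge> M" for m using that by force
      \<comment> \<open>outside the \<open>\<delta>\<close>-neighbourhood a step never overshoots, so it shortens the distance by its length\<close>
      have dec: "\<bar>d (M + n)\<bar> + (\<Sum>i<n. c (i + M)) = \<bar>d M\<bar>" for n
      proof (induction n)
        case (Suc n)
        then show ?case
          using M[of "M + n"] big[of "M + n"] nonneg[of "M + n"] by (auto simp: d_Suc add.commute split: if_splits)
      qed simp
      have "(\<Sum>i<n. c (i + M)) \<le> \<bar>d M\<bar>" for n
        using dec[of n] abs_ge_zero[of "d (M + n)"] by linarith
      then have "summable (\<lambda>i. c (i + M))"
        using nonneg by (intro summableI_nonneg_bounded[where x = "\<bar>d M\<bar>"]) auto
      then show False using div by (simp add: summable_iff_shift)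
    qed
    then obtain m where m: "m \<ge> M" "\<bar>d m\<bar> \<le> \<delta>" by blast
    have "\<bar>d n\<bar> \<le> \<delta>" if "n \<ge> m" for n
      using that
    proof (induction n rule: dec_induct)
      case (step n)
      then show ?case using M[of n] nonneg[of n] m(1) by (auto simp: d_Suc)
    qed (rule m(2))
    then show "\<exists>no. \<forall>n\<ge>no. norm (d n - 0) < \<epsilon>"
      using \<open>0 < \<epsilon>\<close> by (intro exI[of _ m]) (force simp: \<delta>_def)
  qed
  then have "(\<lambda>n. d n + p) \<longlonglongrightarrow> 0 + p" by (intro tendsto_intros)
  then have "(\<lambda>n. \<sigma> n * c n) sums p" by (simp add: sums_def partial)
  then show thesis by (rule that[rotated]) (auto simp: \<sigma>_def)
qed

section \<open>Series built from quadruples of all four sign choices\<close>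

locale sign_quadruples =
  fixes \<alpha> \<beta> :: "nat \<Rightarrow> real" and w :: "nat \<Rightarrow> real \<times> real"
  assumes w0: "w (4 * j) = (- \<alpha> j, - \<beta> j)"
    and w1: "w (4 * j + 1) = (- \<alpha> j, \<beta> j)"
    and w2: "w (4 * j + 2) = (\<alpha> j, \<beta> j)"
    and w3: "w (4 * j + 3) = (\<alpha> j, - \<beta> j)"
    and \<alpha>_pos: "0 < \<alpha> j" and \<beta>_pos: "0 < \<beta> j"
    and \<beta>_0: "\<beta> \<longlonglongrightarrow> 0"
    and ratio_0: "(\<lambda>j. \<alpha> j / \<beta> j) \<longlonglongrightarrow> 0"
    and \<alpha>_div: "\<not> summable \<alpha>"
begin

lemma ratio_small:
  assumes "0 < \<epsilon>"
  shows "\<forall>\<^sub>F j in sequentially. \<alpha> j < \<epsilon> * \<beta> j"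
  using order_tendstoD(2)[OF ratio_0 assms]
  by eventually_elim (use \<beta>_pos in \<open>simp add: field_simps\<close>)

lemma \<alpha>_0: "\<alpha> \<longlonglongrightarrow> 0"
proof -
  have "(\<lambda>j. \<alpha> j / \<beta> j * \<beta> j) \<longlonglongrightarrow> 0 * 0" by (intro tendsto_mult ratio_0 \<beta>_0)
  moreover have "\<alpha> j / \<beta> j * \<beta> j = \<alpha> j" for j using \<beta>_pos[of j] by simp
  ultimately show ?thesis by simp
qed

lemma \<beta>_div: "\<not> summable \<beta>"
proof
  assume "summable \<beta>"
  moreover have "\<forall>\<^sub>F j in sequentially. norm (\<alpha> j) \<le> \<beta> j"
    using ratio_small[OF zero_less_one] by eventually_elim (use \<alpha>_pos in \<open>simp add: less_imp_le\<close>)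
  ultimately have "summable \<alpha>" by (intro summable_comparison_test_ev[of \<alpha> \<beta>])
  then show False using \<alpha>_div by simp
qed

lemma w_cases:
  obtains \<sigma> \<tau> where "\<sigma> \<in> {-1, 1::real}" "\<tau> \<in> {-1, 1::real}"
    "w n = (\<sigma> * \<alpha> (n div 4), \<tau> * \<beta> (n div 4))"
proof -
  define j where "j = n div 4"
  have "n = 4 * j \<or> n = 4 * j + 1 \<or> n = 4 * j + 2 \<or> n = 4 * j + 3"
    unfolding j_def by presburger
  then show thesis
    using that[of "-1" "-1"] that[of "-1" 1] that[of 1 1] that[of 1 "-1"]
      w0[of j] w1[of j] w2[of j] w3[of j]
    by (fold j_def) auto
qed

lemma abs_fst_w: "\<bar>fst (w n)\<bar> = \<alpha> (n div 4)"
  by (rule w_cases[of n]) (use \<alpha>_pos[of "n div 4"] in auto)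

lemma abs_snd_w: "\<bar>snd (w n)\<bar> = \<beta> (n div 4)"
  by (rule w_cases[of n]) (use \<beta>_pos[of "n div 4"] in auto)

lemma \<beta>_le_norm_w: "\<beta> (n div 4) \<le> norm (w n)"
  using abs_snd_w[of n] norm_snd_le[of "snd (w n)" "fst (w n)"] by simp

lemma norm_w_le: "norm (w n) \<le> \<alpha> (n div 4) + \<beta> (n div 4)"
  using norm_Pair_le[of "fst (w n)" "snd (w n)"] by (simp add: abs_fst_w abs_snd_w)

lemma div4: "filterlim (\<lambda>n::nat. n div 4) sequentially sequentially"
  unfolding filterlim_at_top
proof
  fix Z :: nat
  show "\<forall>\<^sub>F n in sequentially. Z \<le> n div 4"
    using eventually_ge_at_top[of "4 * Z"] by eventually_elim simp
qed

lemma w_0: "w \<longlonglongrightarrow> 0"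
proof (rule Lim_null_comparison)
  show "\<forall>\<^sub>F n in sequentially. norm (w n) \<le> \<alpha> (n div 4) + \<beta> (n div 4)"
    by (simp add: norm_w_le)
  have "(\<lambda>j. \<alpha> j + \<beta> j) \<longlonglongrightarrow> 0 + 0" by (intro tendsto_add \<alpha>_0 \<beta>_0)
  then show "(\<lambda>n. \<alpha> (n div 4) + \<beta> (n div 4)) \<longlonglongrightarrow> 0"
    by (auto intro: filterlim_compose[OF _ div4])
qed

text \<open>
  Coefficients in \<open>{0, 1}\<close> keep the terms null, so a subseries may be summed quadruple by quadruple.
\<close>

lemma subseries_sums:
  assumes e: "\<And>n. e n \<in> {0, 1::real}"
    and quad: "(\<lambda>j. e (4 * j) *\<^sub>R w (4 * j) + e (4 * j + 1) *\<^sub>R w (4 * j + 1)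
        + e (4 * j + 2) *\<^sub>R w (4 * j + 2) + e (4 * j + 3) *\<^sub>R w (4 * j + 3)) sums s"
  shows "(\<lambda>n. e n *\<^sub>R w n) sums s"
proof (rule sums_ungroup[of 4])
  show "(\<lambda>n. e n *\<^sub>R w n) \<longlonglongrightarrow> 0"
  proof (rule Lim_null_comparison)
    have "norm (e n *\<^sub>R w n) \<le> norm (w n)" for n using e[of n] by auto
    then show "\<forall>\<^sub>F n in sequentially. norm (e n *\<^sub>R w n) \<le> norm (w n)" by simp
    show "(\<lambda>n. norm (w n)) \<longlonglongrightarrow> 0" using w_0 by (rule tendsto_norm_zero)
  qed
  have "{j * 4..<j * 4 + 4} = {4 * j, 4 * j + 1, 4 * j + 2, 4 * j + 3}" for j :: nat by auto
  then show "(\<lambda>j. \<Sum>n\<in>{j * 4..<j * 4 + 4}. e n *\<^sub>R w n) sums s"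
    using quad by (simp add: add.assoc)
qed simp

lemma conditionally_convergent_w: "conditionally_convergent w"
  unfolding conditionally_convergent_def
proof
  have "(\<lambda>n. 1 *\<^sub>R w n) sums 0"
    by (rule subseries_sums, simp, unfold w0 w1 w2 w3) (simp flip: zero_prod_def)
  then show "summable w" by (auto simp: sums_iff)
  show "\<not> summable (\<lambda>n. norm (w n))"
  proof
    assume "summable (\<lambda>n. norm (w n))"
    moreover have "strict_mono (\<lambda>j::nat. 4 * j)" by (simp add: strict_mono_def)
    ultimately have "summable ((\<lambda>n. norm (w n)) \<circ> (\<lambda>j. 4 * j))"
      by (intro summable_reindex) (auto simp: strict_mono_imp_increasing strict_mono_imp_inj_on)
    then have "summable \<beta>"
    proof (rule summable_comparison_test')
      fix j
      show "norm (\<beta> j) \<le> ((\<lambda>n. norm (w n)) \<circ> (\<lambda>j. 4 * j)) j"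
        using \<beta>_le_norm_w[of "4 * j"] \<beta>_pos[of j] by simp
    qed
    then show False using \<beta>_div by simp
  qed
qed

text \<open>
  Each quadruple contains every sign combination exactly once, so selecting the vector with the
  signs given by two independent greedy choices controls both coordinates at the same time.
\<close>

lemma achievement_set_w: "achievement_set w = UNIV"
proof -
  have "(p, q) \<in> achievement_set w" for p q
  proof -
    obtain \<sigma> where \<sigma>: "\<And>n. \<sigma> n \<in> {-1, 1}" "(\<lambda>n. \<sigma> n * \<alpha> n) sums p"
      using exists_signs_sums[of \<alpha>] \<alpha>_0 \<alpha>_div \<alpha>_pos less_imp_le by metis
    obtain \<tau> where \<tau>: "\<And>n. \<tau> n \<in> {-1, 1}" "(\<lambda>n. \<tau> n * \<beta> n) sums q"
      using exists_signs_sums[of \<beta>] \<beta>_0 \<beta>_div \<beta>_pos less_imp_le by metis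
    define e where "e n = (if w n = (\<sigma> (n div 4) * \<alpha> (n div 4), \<tau> (n div 4) * \<beta> (n div 4))
      then 1 else 0 :: real)" for n
    have "(\<lambda>n. e n *\<^sub>R w n) sums (p, q)"
    proof (rule subseries_sums)
      have "e (4 * j) *\<^sub>R w (4 * j) + e (4 * j + 1) *\<^sub>R w (4 * j + 1)
        + e (4 * j + 2) *\<^sub>R w (4 * j + 2) + e (4 * j + 3) *\<^sub>R w (4 * j + 3)
        = (\<sigma> j * \<alpha> j, \<tau> j * \<beta> j)" for j
      proof -
        define c where "c n = (if w n = (\<sigma> j * \<alpha> j, \<tau> j * \<beta> j) then 1 else 0 :: real)" for n
        have d: "4 * j div 4 = j" "(4 * j + 1) div 4 = j" "(4 * j + 2) div 4 = j" "(4 * j + 3) div 4 = j"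
          by simp_all
        have e: "e (4 * j) = c (4 * j)" "e (4 * j + 1) = c (4 * j + 1)"
          "e (4 * j + 2) = c (4 * j + 2)" "e (4 * j + 3) = c (4 * j + 3)"
          unfolding e_def c_def d by (rule refl)+
        have "\<sigma> j = -1 \<or> \<sigma> j = 1" "\<tau> j = -1 \<or> \<tau> j = 1"
          using \<sigma>(1)[of j] \<tau>(1)[of j] by auto
        moreover have "- \<alpha> j \<noteq> \<alpha> j" "\<alpha> j \<noteq> - \<alpha> j" "- \<beta> j \<noteq> \<beta> j" "\<beta> j \<noteq> - \<beta> j"
          using \<alpha>_pos[of j] \<beta>_pos[of j] by simp_all
        ultimately show ?thesis
          unfolding e c_def w0 w1 w2 w3
          by (elim disjE) (simp_all flip: zero_prod_def)
      qed
      then show "(\<lambda>j. e (4 * j) *\<^sub>R w (4 * j) + e (4 * j + 1) *\<^sub>R w (4 * j + 1)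
        + e (4 * j + 2) *\<^sub>R w (4 * j + 2) + e (4 * j + 3) *\<^sub>R w (4 * j + 3)) sums (p, q)"
        using tendsto_Pair[OF \<sigma>(2)[unfolded sums_def] \<tau>(2)[unfolded sums_def]]
        by (simp only: sums_def sum_prod)
    qed (simp add: e_def)
    then have "(p, q) = (\<Sum>n. e n *\<^sub>R w n)" "summable (\<lambda>n. e n *\<^sub>R w n)"
      by (auto simp: sums_iff)
    moreover have "\<forall>n. e n \<in> {0, 1}" by (simp add: e_def)
    ultimately show ?thesis unfolding achievement_set_def by blast
  qed
  then show ?thesis by auto
qed

text \<open>
  The members at a fixed position in the quadruples form a subseries whose directions converge to
  \<open>(0, \<tau>)\<close>, so eventually all of them lie in the cone, and their norms dominate the \<open>\<beta> j\<close>.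
\<close>

lemma vertical_levy_vector:
  assumes r: "r < 4" and \<tau>: "\<tau> \<in> {-1, 1}" and w: "\<And>j. snd (w (4 * j + r)) = \<tau> * \<beta> j"
  shows "levy_vector w (0, \<tau>)"
  unfolding levy_vector_def
proof (intro conjI allI impI notI)
  show "norm (0 :: real, \<tau>) = 1" using \<tau> by auto
  fix \<epsilon> :: real
  assume \<epsilon>: "0 < \<epsilon>"
  assume sm: "(\<lambda>n. norm (w n)) summable_on {n. w n \<in> levy_cone \<epsilon> (0, \<tau>)}"
  obtain J where J: "\<And>j. J \<le> j \<Longrightarrow> \<alpha> j < \<epsilon> * \<beta> j"
    using ratio_small[OF \<epsilon>] unfolding eventually_sequentially by blast
  have cone: "w (4 * j + r) \<in> levy_cone \<epsilon> (0, \<tau>)" if "J \<le> j" for j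
  proof -
    have "(4 * j + r) div 4 = j" using r by simp
    then have n1: "norm (w (4 * j + r)) \<le> \<alpha> j + \<beta> j" using norm_w_le[of "4 * j + r"] by simp
    have "(1 - \<epsilon>) * norm (w (4 * j + r)) \<le> \<beta> j"
    proof (cases "\<epsilon> \<le> 1")
      case True
      then have "(1 - \<epsilon>) * norm (w (4 * j + r)) \<le> (1 - \<epsilon>) * (\<alpha> j + \<beta> j)"
        using n1 by (intro mult_left_mono) auto
      also have "\<dots> = \<beta> j + \<alpha> j - \<epsilon> * \<alpha> j - \<epsilon> * \<beta> j" by (simp add: algebra_simps)
      also have "\<dots> \<le> \<beta> j" using J[OF that] mult_pos_pos[OF \<epsilon> \<alpha>_pos[of j]] by linarith
      finally show ?thesis .
    next
      case False
      then have "(1 - \<epsilon>) * norm (w (4 * j + r)) \<le> 0" by (simp add: mult_nonpos_nonneg)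
      then show ?thesis using \<beta>_pos[of j] by linarith
    qed
    then show ?thesis using \<tau> w[of j]
      by (cases "w (4 * j + r)") (auto simp: levy_cone_def)
  qed
  define g where "g j = 4 * j + r" for j
  have "(\<lambda>n. norm (w n)) summable_on g ` {J..}"
    by (rule summable_on_subset_banach[OF sm]) (auto simp: g_def cone)
  moreover have "inj_on g {J..}" by (auto simp: g_def inj_on_def)
  ultimately have "((\<lambda>n. norm (w n)) \<circ> g) summable_on {J..}"
    by (simp add: summable_on_reindex)
  then have "\<beta> summable_on {J..}"
  proof (rule summable_on_comparison_test)
    fix j
    show "0 \<le> \<beta> j" using \<beta>_pos[of j] by simp
    have "(4 * j + r) div 4 = j" using r by simp
    then show "\<beta> j \<le> ((\<lambda>n. norm (w n)) \<circ> g) j"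
      using \<beta>_le_norm_w[of "4 * j + r"] by (simp add: g_def)
  qed
  then have "\<beta> summable_on ({J..} \<union> {..<J})"
    by (rule summable_on_union) simp
  moreover have "{J..} \<union> {..<J} = UNIV" by auto
  ultimately have "summable \<beta>" using summable_on_imp_summable by metis
  then show False using \<beta>_div by simp
qed

text \<open>
  If the second component of \<open>u\<close> is smaller than \<open>1\<close> in modulus, the cosine of the angle between \<open>u\<close>
  and the nearly vertical terms stays away from \<open>1\<close>; thus some cone around \<open>u\<close> contains only
  finitely many terms.
\<close>

lemma levy_vector_vertical:
  assumes "levy_vector w u"
  shows "u \<in> {(0, 1), (0, -1)}"
proof -
  obtain u1 u2 where u: "u = (u1, u2)" by (cases u)
  have nrm: "norm u = 1" using assms by (simp add: levy_vector_def)
  then have sq: "u1\<^sup>2 + u2\<^sup>2 = 1" by (simp add: u norm_Pair)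
  have abs1: "\<bar>u1\<bar> \<le> 1" and abs2: "\<bar>u2\<bar> \<le> 1"
    using norm_fst_le[of u1 u2] norm_snd_le[of u2 u1] nrm by (simp_all add: u)
  have "\<bar>u2\<bar> = 1"
  proof (rule ccontr)
    assume "\<bar>u2\<bar> \<noteq> 1"
    \<comment> \<open>\<open>1 - \<epsilon>\<close> is halfway between \<open>1\<close> and the limit \<open>\<bar>u2\<bar>\<close> of the moduli of these cosines\<close>
    define \<epsilon> where "\<epsilon> = (1 - \<bar>u2\<bar>) / 2"
    have \<epsilon>: "0 < \<epsilon>" "\<epsilon> < 1" "1 - \<epsilon> = \<epsilon> + \<bar>u2\<bar>" using \<open>\<bar>u2\<bar> \<noteq> 1\<close> abs2 by (auto simp: \<epsilon>_def field_simps)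
    obtain J where J: "\<And>j. J \<le> j \<Longrightarrow> \<alpha> j < \<epsilon> * \<beta> j"
      using ratio_small[OF \<epsilon>(1)] unfolding eventually_sequentially by blast
    have "n < 4 * J" if "w n \<in> levy_cone \<epsilon> u" for n
    proof (rule ccontr)
      assume "\<not> n < 4 * J"
      define j where "j = n div 4"
      have "J \<le> j" using \<open>\<not> n < 4 * J\<close> by (simp add: j_def)
      have "(1 - \<epsilon>) * \<beta> j \<le> (1 - \<epsilon>) * norm (w n)"
        using \<beta>_le_norm_w[of n] \<epsilon> by (intro mult_left_mono) (auto simp: j_def)
      also have "\<dots> \<le> u \<bullet> w n" using that nrm by (simp add: levy_cone_def)
      also have "\<dots> = u1 * fst (w n) + u2 * snd (w n)" by (simp add: u inner_prod_def)
      also have "\<dots> \<le> \<bar>u1\<bar> * \<bar>fst (w n)\<bar> + \<bar>u2\<bar> * \<bar>snd (w n)\<bar>"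
        by (intro add_mono) (metis abs_ge_self abs_mult)+
      also have "\<dots> \<le> 1 * \<alpha> j + \<bar>u2\<bar> * \<beta> j"
        unfolding abs_fst_w abs_snd_w j_def
        by (intro add_mono mult_right_mono abs1) (auto simp: \<alpha>_pos \<beta>_pos less_imp_le)
      finally have "\<epsilon> * \<beta> j \<le> \<alpha> j" using \<epsilon>(3) by (simp add: algebra_simps)
      then show False using J[OF \<open>J \<le> j\<close>] by simp
    qed
    then have "{n. w n \<in> levy_cone \<epsilon> u} \<subseteq> {..<4 * J}" by auto
    then have "finite {n. w n \<in> levy_cone \<epsilon> u}" by (rule finite_subset) simp
    then have "(\<lambda>n. norm (w n)) summable_on {n. w n \<in> levy_cone \<epsilon> u}" by simp
    then show False using assms \<epsilon>(1) by (simp add: levy_vector_def)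
  qed
  then have "u2\<^sup>2 = 1" using abs_square_eq_1[of u2] by blast
  then have "u1 = 0" using sq by simp
  then show ?thesis using u \<open>\<bar>u2\<bar> = 1\<close> by auto
qed

lemma levy_vectors_w: "{u. levy_vector w u} = {(0, 1), (0, -1)}"
proof -
  have "levy_vector w (0, 1)" by (rule vertical_levy_vector[of 1]) (simp_all add: w1[simplified])
  moreover have "levy_vector w (0, -1)" by (rule vertical_levy_vector[of 0]) (simp_all add: w0)
  ultimately show ?thesis using levy_vector_vertical by auto
qed

text \<open>
  A criterion in the spirit of Liouville: scaling by \<open>q K\<close> makes the contribution of the first \<open>J K\<close>
  quadruples to the abscissa an integer, while the scaled remainder is at most \<open>\<rho> K\<close> times the total
  norm \<open>M\<close> of the subseries. Finiteness of \<open>M\<close> is exactly what absolute convergence provides.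
\<close>

lemma not_abs_achievable:
  fixes q J :: "nat \<Rightarrow> nat" and \<rho> :: "nat \<Rightarrow> real" and t s :: real
  assumes head: "\<And>K j. j < J K \<Longrightarrow> q K * \<alpha> j \<in> \<int>"
    and tail: "\<And>K j. J K \<le> j \<Longrightarrow> q K * \<alpha> j \<le> \<rho> K * \<beta> j"
    and \<rho>0: "\<rho> \<longlonglongrightarrow> 0"
    and \<delta>: "0 < \<delta>" "\<And>K d. d \<in> \<int> \<Longrightarrow> \<delta> \<le> \<bar>q K * t - d\<bar>"
  shows "(t, s) \<notin> abs_achievement_set w"
proof
  assume "(t, s) \<in> abs_achievement_set w"
  then obtain e where e: "\<And>n. e n \<in> {0, 1::real}" and sm: "summable (\<lambda>n. e n * norm (w n))"
    and ts: "(t, s) = (\<Sum>n. e n *\<^sub>R w n)"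
    unfolding abs_achievement_set_def by auto
  have e0: "0 \<le> e n" for n using e[of n] by auto
  define f where "f n = e n * fst (w n)" for n
  define m where "m n = e n * norm (w n)" for n
  have m0: "0 \<le> m n" for n by (simp add: m_def e0)
  have nrm: "norm (e n *\<^sub>R w n) = m n" for n by (simp add: m_def e0)
  have "summable (\<lambda>n. e n *\<^sub>R w n)"
    by (rule summable_norm_cancel) (use sm in \<open>simp only: nrm m_def\<close>)
  then have "(\<lambda>n. e n *\<^sub>R w n) sums (t, s)" by (simp add: ts summable_sums)
  then have "(\<lambda>n. fst (e n *\<^sub>R w n)) sums fst (t, s)" by (rule bounded_linear.sums[OF bounded_linear_fst])
  then have f: "f sums t" by (simp add: f_def[abs_def])
  define M where "M = suminf m"
  have bound: "\<delta> \<le> \<rho> K * M" for K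
  proof -
    define n0 where "n0 = 4 * J K"
    have int: "q K * f n \<in> \<int>" if "n < n0" for n
    proof -
      have "n div 4 < J K" using that by (simp add: n0_def less_mult_imp_div_less mult.commute)
      then have i: "q K * \<alpha> (n div 4) \<in> \<int>" by (rule head)
      have "fst (w n) = \<alpha> (n div 4) \<or> fst (w n) = - \<alpha> (n div 4)"
        using abs_fst_w[of n] by linarith
      then show ?thesis using e[of n] i by (auto simp: f_def)
    qed
    have "q K * (\<Sum>n<n0. f n) \<in> \<int>"
      unfolding sum_distrib_left by (intro Ints_sum int) auto
    then have dist: "\<delta> \<le> \<bar>q K * t - q K * (\<Sum>n<n0. f n)\<bar>" by (rule \<delta>(2))
    have split: "(\<lambda>n. q K * f (n + n0)) sums (q K * (t - (\<Sum>n<n0. f n)))"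
      by (intro sums_mult sums_split_initial_segment f)
    have \<rho>_nonneg: "0 \<le> \<rho> K"
    proof -
      have "0 \<le> q K * \<alpha> (J K)" using \<alpha>_pos[of "J K"] by simp
      also have "\<dots> \<le> \<rho> K * \<beta> (J K)" by (rule tail) simp
      finally show ?thesis using \<beta>_pos[of "J K"] by (simp add: zero_le_mult_iff)
    qed
    have le: "norm (q K * f n) \<le> \<rho> K * m n" if "n0 \<le> n" for n
    proof -
      have "J K \<le> n div 4" using that by (simp add: n0_def)
      then have "q K * \<alpha> (n div 4) \<le> \<rho> K * \<beta> (n div 4)" by (rule tail)
      also have "\<dots> \<le> \<rho> K * norm (w n)" by (intro mult_left_mono \<beta>_le_norm_w \<rho>_nonneg)
      finally have "e n * (q K * \<alpha> (n div 4)) \<le> e n * (\<rho> K * norm (w n))"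
        using e0 by (rule mult_left_mono)
      then show ?thesis by (simp add: f_def m_def abs_mult abs_fst_w e0 mult_ac)
    qed
    have sm': "summable (\<lambda>n. m (n + n0))" using sm unfolding m_def by (subst summable_iff_shift)
    have "norm (\<Sum>n. q K * f (n + n0)) \<le> (\<Sum>n. \<rho> K * m (n + n0))"
      by (rule norm_suminf_le) (use le sm' in \<open>auto intro: summable_mult\<close>)
    also have "\<dots> = \<rho> K * (\<Sum>n. m (n + n0))" by (rule suminf_mult[OF sm'])
    also have "\<dots> \<le> \<rho> K * M"
    proof (rule mult_left_mono[OF _ \<rho>_nonneg])
      have "M = (\<Sum>n. m (n + n0)) + (\<Sum>n<n0. m n)"
        unfolding M_def by (rule suminf_split_initial_segment) (use sm in \<open>simp add: m_def[abs_def]\<close>)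
      moreover have "0 \<le> (\<Sum>n<n0. m n)" by (intro sum_nonneg m0)
      ultimately show "(\<Sum>n. m (n + n0)) \<le> M" by linarith
    qed
    finally have "\<bar>q K * t - q K * (\<Sum>n<n0. f n)\<bar> \<le> \<rho> K * M"
      using sums_unique[OF split] by (simp add: right_diff_distrib)
    with dist show ?thesis by linarith
  qed
  have "(\<lambda>K. \<rho> K * M) \<longlonglongrightarrow> 0" using tendsto_mult_left_zero[OF \<rho>0] .
  from LIMSEQ_le_const[OF this, of \<delta>] show False using bound \<delta>(1) by fastforce
qed

end

section \<open>The blocks\<close>

text \<open>
  \<open>quads k\<close> is the number of quadruples in the first \<open>k\<close> blocks, i.e. half of the bound \<open>n_k\<close> of the
  construction: two consecutive indices, with equal entries since \<open>n_k\<close> is even, share a quadruple.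
\<close>

primrec quads :: "nat \<Rightarrow> nat" where
  "quads 0 = 0"
| "quads (Suc k) = quads k + 4 ^ (Suc k)\<^sup>2 div 2"

definition block :: "nat \<Rightarrow> nat" where
  "block j = (LEAST k. j < quads k)"

lemma four_power_even: "2 * ((4::nat) ^ (Suc k)\<^sup>2 div 2) = 4 ^ (Suc k)\<^sup>2"
  by (intro dvd_mult_div_cancel) (simp add: power2_eq_square)

lemma quads_less_Suc: "quads k < quads (Suc k)"
proof -
  have "(2::nat) \<le> 4 ^ 1" by simp
  also have "\<dots> \<le> 4 ^ (Suc k)\<^sup>2" by (intro power_increasing) simp_all
  finally have "0 < (4::nat) ^ (Suc k)\<^sup>2 div 2"
    by (intro iffD2[OF div_greater_zero_iff] conjI) simp_all
  then show ?thesis unfolding quads.simps by linarith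
qed

lemma strict_mono_quads: "strict_mono quads"
  by (rule strict_monoI_Suc) (rule quads_less_Suc)

lemma block_le_iff: "block j \<le> K \<longleftrightarrow> j < quads K"
proof
  have "j < quads (Suc j)"
    using seq_suble[OF strict_mono_quads, of "Suc j"] by simp
  then have "j < quads (block j)" unfolding block_def by (rule LeastI)
  also assume "block j \<le> K"
  then have "quads (block j) \<le> quads K" by (rule strict_mono_leD[OF strict_mono_quads])
  finally show "j < quads K" .
next
  assume "j < quads K"
  then show "block j \<le> K" unfolding block_def by (rule Least_le)
qed

lemma block_pos: "0 < block j"
  using block_le_iff[of j 0] by auto

lemma filterlim_block: "filterlim block sequentially sequentially"
  unfolding filterlim_at_top
proof
  fix Z
  show "\<forall>\<^sub>F j in sequentially. Z \<le> block j"
    using eventually_ge_at_top[of "quads Z"]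
    by eventually_elim (metis block_le_iff nat_le_linear not_less order_refl le_antisym)
qed

definition width :: "nat \<Rightarrow> real" where "width j = 1 / 4 ^ (block j)\<^sup>2"
definition height :: "nat \<Rightarrow> real" where "height j = 1 / 2 ^ block j"

text \<open>
  For \<open>k = block j\<close>, the exponents of \<open>2\<close> satisfy \<open>2 K^2 + K + k \<le> 2 k^2\<close>; the
  square in the exponent makes up for the factors \<open>2^K\<close> and \<open>2^k\<close>.
\<close>

lemma width_height_tail:
  assumes "K < block j"
  shows "4 ^ K\<^sup>2 * width j \<le> (1 / 2) ^ K * height j"
proof -
  obtain d where d: "block j = Suc (K + d)" using assms less_imp_Suc_add by blast
  have "2 * K\<^sup>2 + K + block j \<le> 2 * (block j)\<^sup>2" by (simp add: d power2_eq_square algebra_simps)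
  then have "(2::real) ^ (2 * K\<^sup>2 + K + block j) \<le> 2 ^ (2 * (block j)\<^sup>2)"
    by (intro power_increasing) auto
  then have "4 ^ K\<^sup>2 * 2 ^ K * 2 ^ block j \<le> (4::real) ^ (block j)\<^sup>2"
    by (simp add: power_add power_mult)
  then show ?thesis by (simp add: width_def height_def field_simps)
qed

lemma width_height_ratio: "width j / height j \<le> (1 / 2) ^ block j"
proof -
  have "2 * block j \<le> 2 * (block j)\<^sup>2" by (simp add: power2_nat_le_imp_le power2_eq_square)
  then have "(2::real) ^ (2 * block j) \<le> 2 ^ (2 * (block j)\<^sup>2)" by (intro power_increasing) auto
  then have "2 ^ block j * 2 ^ block j \<le> (4::real) ^ (block j)\<^sup>2"
    unfolding power_mult[of 2 2] by (simp add: power_mult_distrib[symmetric])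
  then show ?thesis by (simp add: width_def height_def field_simps)
qed

lemma sum_width_block: "sum width {quads K..<quads (Suc K)} = 1 / 2"
proof -
  have "width j = 1 / 4 ^ (Suc K)\<^sup>2" if "j \<in> {quads K..<quads (Suc K)}" for j
  proof -
    have "block j = Suc K"
      using that block_le_iff[of j K] block_le_iff[of j "Suc K"] by auto
    then show ?thesis by (simp add: width_def)
  qed
  then have "sum width {quads K..<quads (Suc K)} = real (4 ^ (Suc K)\<^sup>2 div 2) * (1 / 4 ^ (Suc K)\<^sup>2)"
    by (simp del: power_Suc)
  also have "\<dots> = 1 / 2"
  proof -
    have "2 * real (4 ^ (Suc K)\<^sup>2 div 2) = 4 ^ (Suc K)\<^sup>2"
      by (metis four_power_even of_nat_mult of_nat_numeral of_nat_power)
    then show ?thesis by (simp add: field_simps del: power_Suc)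
  qed
  finally show ?thesis .
qed

lemma not_summable_width: "\<not> summable width"
proof
  assume "summable width"
  then obtain M where M: "\<And>m n. M \<le> m \<Longrightarrow> norm (sum width {m..<n}) < 1 / 2"
    unfolding summable_Cauchy by (meson half_gt_zero_iff zero_less_one)
  have "M \<le> quads M" by (rule seq_suble[OF strict_mono_quads])
  from M[OF this, of "quads (Suc M)"] show False by (simp add: sum_width_block del: quads.simps)
qed

lemma third_far_from_Ints:
  assumes "d \<in> \<int>"
  shows "1 / 3 \<le> \<bar>real (4 ^ n) * (1 / 3) - d\<bar>"
proof -
  obtain z where z: "d = of_int z" using assms by (elim Ints_cases)
  have "(4::int) ^ n mod 3 = 1"
    using power_mod[of "4::int" 3 n] by simp
  then have "1 \<le> \<bar>4 ^ n - 3 * z\<bar>" by presburger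
  then have "(1::real) \<le> \<bar>4 ^ n - 3 * d\<bar>"
    unfolding z by (metis (mono_tags) of_int_1_le_iff of_int_abs of_int_diff of_int_mult of_int_numeral of_int_power)
  then show ?thesis by (simp add: abs_if split: if_splits)
qed

theorem mainTheorem3:
  fixes N :: "nat \<Rightarrow> nat" and x y :: "nat \<Rightarrow> real" and v :: "nat \<Rightarrow> real \<times> real"
  assumes "N 0 = 0"
    and "\<And>k. k \<ge> 1 \<Longrightarrow> N k = 4 ^ (k\<^sup>2) + N (k - 1)"
    and "\<And>k n. k \<ge> 1 \<Longrightarrow> n \<in> {N (k - 1)<..N k} \<Longrightarrow> x n = 1 / 4 ^ (k\<^sup>2)"
    and "\<And>k n. k \<ge> 1 \<Longrightarrow> n \<in> {N (k - 1)<..N k} \<Longrightarrow> y n = 1 / 2 ^ k"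
    and "\<And>n. n \<ge> 1 \<Longrightarrow> v (4 * n - 3) = (- x (2 * n - 1), - y (2 * n - 1))"
    and "\<And>n. n \<ge> 1 \<Longrightarrow> v (4 * n - 2) = (- x (2 * n - 1), y (2 * n - 1))"
    and "\<And>n. n \<ge> 1 \<Longrightarrow> v (4 * n - 1) = (x (2 * n), y (2 * n))"
    and "\<And>n. n \<ge> 1 \<Longrightarrow> v (4 * n) = (x (2 * n), - y (2 * n))"
  shows "conditionally_convergent (\<lambda>n. v (Suc n))
    \<and> card {u. levy_vector (\<lambda>n. v (Suc n)) u} = 2
    \<and> achievement_set (\<lambda>n. v (Suc n)) = UNIV
    \<and> abs_achievement_set (\<lambda>n. v (Suc n)) \<inter> ({1 / 3} \<times> UNIV) = {}
    \<and> abs_achievement_set (\<lambda>n. v (Suc n)) \<noteq> achievement_set (\<lambda>n. v (Suc n))"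
proof -
  note N0 = assms(1) and NS = assms(2) and x = assms(3) and y = assms(4)
    and v1 = assms(5) and v2 = assms(6) and v3 = assms(7) and v4 = assms(8)
  have N: "N k = 2 * quads k" for k
  proof (induction k)
    case (Suc k)
    have "N (Suc k) = 4 ^ (Suc k)\<^sup>2 + N k" using NS[of "Suc k"] by simp
    then show ?case using Suc four_power_even[of k] by (simp del: power_Suc)
  qed (simp add: N0)
  have xy: "x (2 * Suc j - i) = width j" "y (2 * Suc j - i) = height j" if "i \<le> 1" for i j
  proof -
    have "\<not> j < quads (block j - 1)" "j < quads (block j)" "1 \<le> block j"
      using block_pos[of j] unfolding block_le_iff[symmetric] by auto
    then have "2 * Suc j - i \<in> {N (block j - 1)<..N (block j)}"
      using that by (auto simp: N)
    then show "x (2 * Suc j - i) = width j" "y (2 * Suc j - i) = height j"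
      using x y \<open>1 \<le> block j\<close> by (auto simp: width_def height_def)
  qed
  define w where "w n = v (Suc n)" for n
  interpret sign_quadruples width height w
  proof
    fix j
    have n: "4 * Suc j - 3 = Suc (4 * j)" "4 * Suc j - 2 = Suc (4 * j + 1)"
      "4 * Suc j - 1 = Suc (4 * j + 2)" "4 * Suc j = Suc (4 * j + 3)" by simp_all
    have o: "x (2 * Suc j - 1) = width j" "y (2 * Suc j - 1) = height j"
      "x (2 * Suc j) = width j" "y (2 * Suc j) = height j"
      using xy[of 1 j] xy[of 0 j] by simp_all
    show "w (4 * j) = (- width j, - height j)" "w (4 * j + 1) = (- width j, height j)"
      "w (4 * j + 2) = (width j, height j)" "w (4 * j + 3) = (width j, - height j)"
      using v1[of "Suc j"] v2[of "Suc j"] v3[of "Suc j"] v4[of "Suc j"]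
      unfolding w_def n[symmetric] o by simp_all
    show "0 < width j" "0 < height j" by (simp_all add: width_def height_def)
  next
    have h: "(\<lambda>j. (1 / 2 :: real) ^ block j) \<longlonglongrightarrow> 0"
      by (rule filterlim_compose[OF LIMSEQ_power_zero filterlim_block]) simp
    then show "height \<longlonglongrightarrow> 0" by (simp add: height_def[abs_def] power_one_over)
    show "(\<lambda>j. width j / height j) \<longlonglongrightarrow> 0"
      by (rule Lim_null_comparison[OF _ h]) (use width_height_ratio in \<open>simp add: width_def height_def\<close>)
    show "\<not> summable width" by (rule not_summable_width)
  qed
  have abs: "(1 / 3, s) \<notin> abs_achievement_set w" for s
  proof (rule not_abs_achievable[where q = "\<lambda>K. 4 ^ K\<^sup>2" and J = quads and \<delta> = "1 / 3" and \<rho> = "\<lambda>K. (1 / 2) ^ K"])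
    fix K j
    assume "j < quads K"
    then have "block j \<le> K" by (simp add: block_le_iff)
    then have "(block j)\<^sup>2 \<le> K\<^sup>2" by (rule power_mono) simp
    then have "real (4 ^ K\<^sup>2) * width j = 4 ^ (K\<^sup>2 - (block j)\<^sup>2)"
      by (simp add: width_def power_diff)
    then show "real (4 ^ K\<^sup>2) * width j \<in> \<int>" by simp
  next
    fix K j
    assume "quads K \<le> j"
    then have "K < block j" using block_le_iff[of j K] by auto
    then show "real (4 ^ K\<^sup>2) * width j \<le> (1 / 2) ^ K * height j" using width_height_tail by simp
  next
    show "(\<lambda>K. (1 / 2 :: real) ^ K) \<longlonglongrightarrow> 0" by (rule LIMSEQ_power_zero) simp
    show "(0 :: real) < 1 / 3" by simp
    show "1 / 3 \<le> \<bar>real (4 ^ K\<^sup>2) * (1 / 3) - d\<bar>" if "d \<in> \<int>" for K d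
      using that by (rule third_far_from_Ints)
  qed
  have "card {(0 :: real, 1 :: real), (0, -1)} = 2" by simp
  then show ?thesis
    using conditionally_convergent_w levy_vectors_w achievement_set_w abs
    unfolding w_def[abs_def, symmetric] by auto
qed

end
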